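(* A graph $G$ can be $12$-represented by a permutation if and only if $G$ is a permutation graph.
   Context: All graphs are simple and finite. For a word $w$ over the positive integers, $A(w)$ is the set of letters occurring in $w$; for $B\subseteq A(w)$, $w_B$ is the word obtained from $w$ by deleting all letters not in $B$. A word $w=w_1\cdots w_m$ has a $12$-match if $w_i<w_{i+1}$ for some $i$. A word $w\in[n]^*$ with $A(w)=[n]=\{1,\ldots,n\}$ $12$-represents a labeled graph $([n],E)$ if for all distinct $x,y\in[n]$: $xy\in E$ if and only if $w_{\{x,y\}}$ has no $12$-match. An unlabeled graph $G$ on $n$ vertices can be $12$-represented by a permutation if for some labeling of its vertices by $[n]$ there is a permutation of $[n]$, written as a word in which each letter of $[n]$ occurs exactly once, that $12$-represents the labeled graph. A graph $G$ on $n$ vertices is a permutation graph if it has a labeling $G=([n],E)$ for which there is a permutation $\sigma$ of $[n]$ such that for all $1\leq i<j\leq n$: $ij\in E$ if and only if $j$ occurs before $i$ in $\sigma$ (written as a word). *)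

theory Defs
  imports "Graph_Theory.Pair_Digraph" "HOL-Combinatorics.Multiset_Permutations"
begin

text \<open>
  Finite simple graphs are the structures satisfying \<open>pair_graph\<close>: finite vertex set and a
  symmetric, loop-free arc set, so an edge \<open>uv\<close> is the pair of arcs \<open>(u, v)\<close> and \<open>(v, u)\<close>.
  Words are lists of natural numbers; the letters of the words below are positive because
  they are required to form a set \<open>{1..n}\<close>.
\<close>

definition restrict_word :: "nat list \<Rightarrow> nat set \<Rightarrow> nat list" where
  "restrict_word w B = filter (\<lambda>x. x \<in> B) w"

definition has_12_match :: "nat list \<Rightarrow> bool" where
  "has_12_match w \<longleftrightarrow> (\<exists>i. Suc i < length w \<and> w ! i < w ! Suc i)"

definition represents_12 :: "nat \<Rightarrow> nat list \<Rightarrow> nat pair_pre_digraph \<Rightarrow> bool" where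
  "represents_12 n w H \<longleftrightarrow>
     pverts H = {1..n} \<and> set w = {1..n} \<and>
     (\<forall>x\<in>{1..n}. \<forall>y\<in>{1..n}. x \<noteq> y \<longrightarrow>
        ((x, y) \<in> parcs H \<longleftrightarrow> \<not> has_12_match (restrict_word w {x, y})))"

definition is_labeling :: "('a \<Rightarrow> nat) \<Rightarrow> 'a pair_pre_digraph \<Rightarrow> bool" where
  "is_labeling f G \<longleftrightarrow> bij_betw f (pverts G) {1..card (pverts G)}"

definition relabel :: "('a \<Rightarrow> 'b) \<Rightarrow> 'a pair_pre_digraph \<Rightarrow> 'b pair_pre_digraph" where
  "relabel f G = \<lparr> pverts = f ` pverts G, parcs = map_prod f f ` parcs G \<rparr>"

definition perm_12_representable :: "'a pair_pre_digraph \<Rightarrow> bool" where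
  "perm_12_representable G \<longleftrightarrow>
     (\<exists>f. is_labeling f G \<and>
       (\<exists>\<sigma>\<in>permutations_of_set {1..card (pverts G)}.
          represents_12 (card (pverts G)) \<sigma> (relabel f G)))"

definition occurs_before :: "'a list \<Rightarrow> 'a \<Rightarrow> 'a \<Rightarrow> bool" where
  "occurs_before w x y \<longleftrightarrow> (\<exists>p q. p < q \<and> q < length w \<and> w ! p = x \<and> w ! q = y)"

definition permutation_graph :: "'a pair_pre_digraph \<Rightarrow> bool" where
  "permutation_graph G \<longleftrightarrow>
     (\<exists>f. is_labeling f G \<and>
       (\<exists>\<sigma>\<in>permutations_of_set {1..card (pverts G)}.
          \<forall>i j. 1 \<le> i \<and> i < j \<and> j \<le> card (pverts G) \<longrightarrow>
            ((i, j) \<in> parcs (relabel f G) \<longleftrightarrow> occurs_before \<sigma> j i)))"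

end

theory Submission
  imports Defs
begin

text \<open>
  Both properties are witnessed by the same labelings and the same permutations. In a permutation
  two letters \<open>i < j\<close> occur once each, so the word restricted to \<open>{i, j}\<close> is one of \<open>ij\<close> and \<open>ji\<close>;
  only the first has a 12-match. Hence the absence of a 12-match says precisely that \<open>j\<close> occurs
  before \<open>i\<close> (\<open>no_12_match_iff_inversion\<close>). What remains is that 12-representation speaks of
  unordered pairs and the inversion condition only of pairs \<open>i < j\<close>: the restricted word depends
  only on the set \<open>{i, j}\<close>, and the arc set is symmetric.
\<close>

lemma restrict_word_pair:
  assumes "distinct w" "occurs_before w x y"
  shows "restrict_word w {x, y} = [x, y]"
proof -
  obtain p q where pq: "p < q" "q < length w" "w ! p = x" "w ! q = y"
    using assms(2) unfolding occurs_before_def by blast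
  have w: "w = take p w @ x # drop (Suc p) w"
    using pq id_take_nth_drop[of p w] by simp
  have "drop (Suc p) w ! (q - Suc p) = y" "q - Suc p < length (drop (Suc p) w)"
    using pq by auto
  then have "y \<in> set (drop (Suc p) w)" by (metis nth_mem)
  then obtain bs cs where "drop (Suc p) w = bs @ y # cs"
    by (meson split_list)
  with w obtain as where split: "w = as @ x # bs @ y # cs" by metis
  then have "\<forall>z\<in>set as \<union> set bs \<union> set cs. z \<noteq> x \<and> z \<noteq> y"
    using assms(1) by auto
  then show ?thesis
    unfolding restrict_word_def split by (auto simp: filter_empty_conv)
qed

lemma occurs_before_total:
  assumes "x \<in> set w" "y \<in> set w" "x \<noteq> y"
  shows "occurs_before w x y \<or> occurs_before w y x"
  using assms unfolding in_set_conv_nth occurs_before_def by (metis linorder_neqE_nat)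

lemma has_12_match_pair: "has_12_match [x, y] \<longleftrightarrow> x < y"
  by (auto simp: has_12_match_def less_Suc_eq)

text \<open>
  With \<open>i < j\<close>, the restricted word is either the descent \<open>ji\<close> or the ascent \<open>ij\<close>, and the order
  of occurrence decides which. Without distinctness the equivalence fails: in \<open>iji\<close> the letter
  \<open>j\<close> occurs before an \<open>i\<close>, yet there is a 12-match.
\<close>

lemma no_12_match_iff_inversion:
  assumes "distinct w" "i \<in> set w" "j \<in> set w" "i < j"
  shows "\<not> has_12_match (restrict_word w {i, j}) \<longleftrightarrow> occurs_before w j i"
proof (cases "occurs_before w j i")
  case True
  then have "restrict_word w {i, j} = [j, i]"
    using restrict_word_pair[OF assms(1)] by (metis insert_commute)
  with True assms(4) show ?thesis by (simp add: has_12_match_pair)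
next
  case False
  then have "restrict_word w {i, j} = [i, j]"
    using occurs_before_total[of i w j] restrict_word_pair assms by blast
  with False assms(4) show ?thesis by (simp add: has_12_match_pair)
qed

lemma sym_parcs_relabel:
  assumes "pair_graph G"
  shows "(x, y) \<in> parcs (relabel f G) \<longleftrightarrow> (y, x) \<in> parcs (relabel f G)"
proof -
  interpret pair_graph G by fact
  have "(v, u) \<in> parcs G" if "(u, v) \<in> parcs G" for u v
    using that arcs_symmetric by blast
  then show ?thesis
    unfolding relabel_def by (fastforce simp: map_prod_def)
qed

text \<open>
  This equivalence is for one fixed labeled graph and one fixed permutation, so the theorem
  follows by quantifying over both.
\<close>

lemma represents_12_permutation_iff:
  assumes sym: "\<And>x y. (x, y) \<in> parcs H \<longleftrightarrow> (y, x) \<in> parcs H"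
    and verts: "pverts H = {1..n}"
    and perm: "\<sigma> \<in> permutations_of_set {1..n}"
  shows "represents_12 n \<sigma> H \<longleftrightarrow>
    (\<forall>i j. 1 \<le> i \<and> i < j \<and> j \<le> n \<longrightarrow> ((i, j) \<in> parcs H \<longleftrightarrow> occurs_before \<sigma> j i))"
    (is "_ \<longleftrightarrow> ?inv")
proof -
  have \<sigma>: "set \<sigma> = {1..n}" "distinct \<sigma>"
    using perm by (auto simp: permutations_of_set_def)
  let ?edge = "\<lambda>x y. (x, y) \<in> parcs H \<longleftrightarrow> \<not> has_12_match (restrict_word \<sigma> {x, y})"
  have match: "\<not> has_12_match (restrict_word \<sigma> {i, j}) \<longleftrightarrow> occurs_before \<sigma> j i"
    if "1 \<le> i" "i < j" "j \<le> n" for i j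
    using no_12_match_iff_inversion[of \<sigma> i j] \<sigma> that by simp
  \<comment> \<open>Interchanging \<open>x\<close> and \<open>y\<close> changes neither side, so pairs in increasing order suffice.\<close>
  have edge_sym: "?edge x y \<longleftrightarrow> ?edge y x" for x y
    using sym by (simp add: insert_commute)
  have "represents_12 n \<sigma> H \<longleftrightarrow> (\<forall>x\<in>{1..n}. \<forall>y\<in>{1..n}. x \<noteq> y \<longrightarrow> ?edge x y)"
    using verts \<sigma> by (simp add: represents_12_def)
  also have "\<dots> \<longleftrightarrow> (\<forall>i j. 1 \<le> i \<and> i < j \<and> j \<le> n \<longrightarrow> ?edge i j)" (is "?all \<longleftrightarrow> ?ordered")
  proof
    assume ?all
    then show ?ordered by simp
  next
    assume ordered: ?ordered
    show ?all
    proof (intro ballI impI)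
      fix x y assume "x \<in> {1..n}" "y \<in> {1..n}" "x \<noteq> y"
      then consider "1 \<le> x \<and> x < y \<and> y \<le> n" | "1 \<le> y \<and> y < x \<and> x \<le> n"
        by fastforce
      then show "?edge x y"
        using ordered edge_sym[of x y] by cases blast+
    qed
  qed
  also have "\<dots> \<longleftrightarrow> ?inv"
    using match by blast
  finally show ?thesis .
qed

theorem proposition1:
  fixes G :: "'a pair_pre_digraph"
  assumes "pair_graph G"
  shows "perm_12_representable G \<longleftrightarrow> permutation_graph G"
proof -
  have "represents_12 (card (pverts G)) \<sigma> (relabel f G) \<longleftrightarrow>
      (\<forall>i j. 1 \<le> i \<and> i < j \<and> j \<le> card (pverts G) \<longrightarrow>
        ((i, j) \<in> parcs (relabel f G) \<longleftrightarrow> occurs_before \<sigma> j i))"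
    if "is_labeling f G" "\<sigma> \<in> permutations_of_set {1..card (pverts G)}" for f \<sigma>
  proof (rule represents_12_permutation_iff[OF sym_parcs_relabel[OF assms] _ that(2)])
    show "pverts (relabel f G) = {1..card (pverts G)}"
      using that(1) by (simp add: is_labeling_def relabel_def bij_betw_def)
  qed
  then show ?thesis
    unfolding perm_12_representable_def permutation_graph_def by blast
qed

end
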